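(* Let $c:[2^{\omega+1}]^2\to \omega+1$ be a $\Delta$-regressive colouring, i.e. $c(x,y)<\Delta(x,y)$ for all distinct $x,y\in 2^{\omega+1}$ with $\Delta(x,y)>0$. Then there is an $m<\omega$ such that, for every natural number $k\geq 3$, $c$ has a monochromatic cycle of colour $m$ and length $k$.
   Context: For an ordinal $\alpha$, $2^\alpha$ denotes the set of all functions from $\alpha$ to $2=\{0,1\}$ (so $2^{\omega+1}$ is the set of functions from the ordinal $\omega+1$ to $2$). $[X]^2$ is the set of two-element subsets of $X$, and $c(x,y)$ abbreviates $c(\{x,y\})$. For distinct $x,y\in 2^\alpha$, $\Delta(x,y)=\min\{i<\alpha : x(i)\neq y(i)\}$. For $c:[X]^2\to Z$, a $c$-monochromatic cycle of colour $m$ and length $k\ge 3$ is an injective sequence $\langle x_i\mid i<k\rangle$ of elements of $X$ such that $c$ takes the constant value $m$ on $\{\{x_i,x_{i+1}\}\mid i+1<k\}\cup\{\{x_{k-1},x_0\}\}$. *)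

theory Defs
  imports "HOL-Library.Extended_Nat"
begin

text \<open>
  The ordinal \<open>\<omega> + 1\<close> is rendered by the well-ordered type \<^typ>\<open>enat\<close>: its elements are
  \<open>0 < 1 < 2 < \<dots> < \<infinity>\<close>, where \<open>\<infinity>\<close> plays the role of \<open>\<omega>\<close>, so that \<open>m < \<omega>\<close> reads \<open>m < \<infinity>\<close>.
  Accordingly \<open>2\<^sup>\<omega>\<^sup>+\<^sup>1\<close> is the full function type \<^typ>\<open>enat \<Rightarrow> bool\<close>. A colouring of the two-element
  subsets of \<open>X\<close> is a function on sets; its values on sets that are not two-element subsets
  of \<open>X\<close> are irrelevant.
\<close>

text \<open>Only meaningful for \<open>x \<noteq> y\<close>.\<close>

definition Delta :: "('i::wellorder \<Rightarrow> bool) \<Rightarrow> ('i \<Rightarrow> bool) \<Rightarrow> 'i" where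
  "Delta x y = (LEAST i. x i \<noteq> y i)"

definition Delta_regressive :: "((enat \<Rightarrow> bool) set \<Rightarrow> enat) \<Rightarrow> bool" where
  "Delta_regressive c \<longleftrightarrow>
     (\<forall>x y. x \<noteq> y \<longrightarrow> Delta x y > 0 \<longrightarrow> c {x, y} < Delta x y)"

text \<open>Only the values \<open>x i\<close> with \<open>i < k\<close> matter.\<close>

definition monochromatic_cycle ::
  "('a set \<Rightarrow> 'z) \<Rightarrow> 'a set \<Rightarrow> 'z \<Rightarrow> nat \<Rightarrow> (nat \<Rightarrow> 'a) \<Rightarrow> bool" where
  "monochromatic_cycle c X m k x \<longleftrightarrow>
     k \<ge> 3 \<and> inj_on x {..<k} \<and> x ` {..<k} \<subseteq> X \<and>
     (\<forall>e \<in> {{x i, x (i + 1)} | i. i + 1 < k} \<union> {{x (k - 1), x 0}}. c e = m)"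

end

theory Submission
  imports Defs
begin

text \<open>
  Let \<open>m\<close> be the least natural number that is the colour of some pair \<open>x, y\<close> with
  \<open>\<Delta>(x, y) \<ge> m + 2\<close>; it exists because a pair with \<open>\<Delta>(x, y) = \<omega>\<close> has a finite colour.
  By minimality, and since \<open>c\<close> is regressive, every pair with \<open>\<Delta> = m + 1\<close> has colour exactly
  \<open>m\<close>. Hence the cone of \<open>x\<close> up to coordinate \<open>m + 1\<close>, which also contains \<open>y\<close>, and the cone
  obtained by flipping that coordinate span an infinite complete bipartite graph of colour \<open>m\<close>.
  Alternating between the two cones gives the even cycles, and the edge \<open>{x, y}\<close> inside one of
  them gives the odd ones.
\<close>

lemma infinite_cone:
  fixes x :: "enat \<Rightarrow> bool"
  shows "infinite {f. \<forall>i\<le>enat n. f i = x i}"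
proof -
  \<comment> \<open>Coordinates above \<open>n\<close> are free: there \<open>h j\<close> is the
    indicator of the single point \<open>n + 1 + j\<close>.\<close>
  define h where "h j i = (if i \<le> enat n then x i else i = enat (n + 1 + j))" for j :: nat and i
  have "inj h"
  proof (rule injI)
    fix j j' assume "h j = h j'"
    then have "h j (enat (n + 1 + j)) = h j' (enat (n + 1 + j))" by simp
    then show "j = j'" by (simp add: h_def)
  qed
  moreover have "range h \<subseteq> {f. \<forall>i\<le>enat n. f i = x i}"
    by (auto simp: h_def)
  ultimately show ?thesis
    using finite_subset range_inj_infinite by blast
qed

text \<open>Alternate between the sides, starting in \<open>A\<close>. For even \<open>k\<close> the
  walk ends in \<open>B\<close> and closes by a bipartite edge; for odd \<open>k\<close> it ends in
  \<open>A\<close>, so it is made to run from \<open>x\<close> to \<open>y\<close>.\<close>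

lemma monochromatic_cycle_bipartite_plus_edge:
  assumes "infinite A" "infinite B" "A \<inter> B = {}"
    and bip: "\<And>a b. a \<in> A \<Longrightarrow> b \<in> B \<Longrightarrow> c {a, b} = m"
    and xy: "x \<in> A" "y \<in> A" "x \<noteq> y" "c {x, y} = m"
    and k: "k \<ge> 3"
  shows "\<exists>u. monochromatic_cycle c UNIV m k u"
proof -
  \<comment> \<open>Removing \<open>x\<close> and \<open>y\<close> first keeps the enumeration
    injective once they are put back in \<open>p\<close>.\<close>
  have "infinite (A - {x, y})" using assms(1) by simp
  then obtain p0 :: "nat \<Rightarrow> 'a" where p0: "inj p0" "range p0 \<subseteq> A - {x, y}"
    using infinite_countable_subset by blast
  obtain q :: "nat \<Rightarrow> 'a" where q: "inj q" "range q \<subseteq> B"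
    using infinite_countable_subset assms(2) by blast
  \<comment> \<open>For odd \<open>k\<close> the last vertex \<open>u (k - 1)\<close> is
    \<open>p l\<close>. As \<open>k \<ge> 3\<close>, \<open>l\<close> is positive, so
    \<open>x\<close> and \<open>y\<close> get different slots.\<close>
  define l where "l = (k - 1) div 2"
  have l: "l > 0" using k by (simp add: l_def)
  define p where "p = p0(0 := x, l := y)"
  have p0ne: "p0 j \<noteq> x" "p0 j \<noteq> y" for j
    using p0(2) by blast+
  have "inj p"
    using p0(1) p0ne p0ne[symmetric] xy(3)
    by (auto simp: p_def inj_def)
  have pA: "p j \<in> A" for j
    using p0(2) xy by (auto simp: p_def)
  have qB: "q j \<in> B" for j
    using q(2) by blast
  have pq: "p i \<noteq> q j" for i j
    using pA qB assms(3) by (metis disjoint_iff)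
  define u where "u i = (if even i then p (i div 2) else q (i div 2))" for i
  have "inj u"
  proof (rule injI)
    fix i j assume eq: "u i = u j"
    then have par: "even i \<longleftrightarrow> even j"
      using pq pq[symmetric] by (auto simp: u_def split: if_splits)
    then have "i div 2 = j div 2"
      using eq \<open>inj p\<close> q(1) by (auto simp: u_def inj_def split: if_splits)
    with par show "i = j"
      by (metis even_two_times_div_two odd_two_times_div_two_succ)
  qed
  have step: "c {u i, u (i + 1)} = m" for i
  proof (cases "even i")
    case True
    then show ?thesis by (simp add: u_def bip pA qB)
  next
    case False
    then show ?thesis using bip[OF pA qB]
      by (simp add: u_def insert_commute[of "q _"])
  qed
  have last: "c {u (k - 1), u 0} = m"
  proof (cases "even (k - 1)")
    case True
    then have "u (k - 1) = y" "u 0 = x"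
      using l by (simp_all add: u_def p_def l_def)
    then show ?thesis using xy(4) by (simp add: insert_commute)
  next
    case False
    then have "u (k - 1) \<in> B" "u 0 \<in> A"
      by (simp_all add: u_def pA qB)
    then show ?thesis using bip by (simp add: insert_commute)
  qed
  have "monochromatic_cycle c UNIV m k u"
    unfolding monochromatic_cycle_def
    using k \<open>inj u\<close> step last by (auto intro: inj_on_subset)
  then show ?thesis by blast
qed

theorem proposition2p2:
  fixes c :: "(enat \<Rightarrow> bool) set \<Rightarrow> enat"
  assumes "Delta_regressive c"
  shows "\<exists>m<\<infinity>. \<forall>k::nat. k \<ge> 3 \<longrightarrow> (\<exists>x. monochromatic_cycle c UNIV m k x)"
proof -
  have reg: "c {x, y} < Delta x y" if "x \<noteq> y" "Delta x y > 0" for x y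
    using assms that by (auto simp: Delta_regressive_def)
  \<comment> \<open>The offset 2 serves twice: \<open>x\<close> and \<open>y\<close> still agree at
    coordinate \<open>m + 1\<close>, and \<open>j < m\<close> gives
    \<open>j + 2 \<le> m + 1\<close>, so a pair with \<open>Delta\<close> equal to
    \<open>m + 1\<close> can witness \<open>P j\<close>.\<close>
  define P where
    "P m \<longleftrightarrow> (\<exists>x y. x \<noteq> y \<and> enat (m + 2) \<le> Delta x y \<and> c {x, y} = enat m)" for m
  have "\<exists>m. P m"
  proof -
    \<comment> \<open>These differ only at the top coordinate, so \<open>Delta\<close> exceeds every
      finite bound while regressivity makes the colour finite.\<close>
    define x y :: "enat \<Rightarrow> bool" where "x = (\<lambda>_. False)" and "y = x(\<infinity> := True)"
    have "x \<noteq> y" by (auto simp: x_def y_def fun_eq_iff)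
    have D: "Delta x y = \<infinity>"
      unfolding Delta_def by (rule Least_equality) (auto simp: x_def y_def split: if_splits)
    with reg[OF \<open>x \<noteq> y\<close>] have "c {x, y} < \<infinity>" by simp
    then obtain m where "c {x, y} = enat m" by auto
    with \<open>x \<noteq> y\<close> D have "P m" unfolding P_def by (intro exI[of _ x] exI[of _ y]) simp
    then show ?thesis ..
  qed
  define m where "m = (LEAST m. P m)"
  have "P m" unfolding m_def using \<open>\<exists>m. P m\<close> by (rule LeastI_ex)
  then obtain x y where xy: "x \<noteq> y" "enat (m + 2) \<le> Delta x y" "c {x, y} = enat m"
    by (auto simp: P_def)
  have min: "\<not> P j" if "j < m" for j
    using that not_less_Least unfolding m_def by blast
  have colour: "c {f, g} = enat m" if "f \<noteq> g" and D: "Delta f g = enat (m + 1)" for f g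
  proof -
    have "Delta f g > 0" using D by (simp add: zero_enat_def)
    from reg[OF \<open>f \<noteq> g\<close> this] obtain j where j: "c {f, g} = enat j" "j < m + 1"
      by (cases "c {f, g}") (auto simp: D)
    \<comment> \<open>Regressivity leaves only \<open>j \<le> m\<close>; minimality of
      \<open>m\<close> excludes the smaller values.\<close>
    have "P j" if "j < m"
      unfolding P_def using that \<open>f \<noteq> g\<close> D j by (intro exI[of _ f] exI[of _ g]) simp
    with min j show ?thesis by (metis Suc_eq_plus1 less_Suc_eq)
  qed
  define x' where "x' = x(enat (m + 1) := \<not> x (enat (m + 1)))"
  define A where "A = {f. \<forall>i\<le>enat (m + 1). f i = x i}"
  define B where "B = {f. \<forall>i\<le>enat (m + 1). f i = x' i}"
  have diff: "f (enat (m + 1)) \<noteq> g (enat (m + 1))" if "f \<in> A" "g \<in> B" for f g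
    using that by (auto simp: A_def B_def x'_def)
  have bip: "c {f, g} = enat m" if fg: "f \<in> A" "g \<in> B" for f g
  proof (rule colour)
    show "f \<noteq> g" using diff[OF fg] by auto
    show "Delta f g = enat (m + 1)"
      unfolding Delta_def
    proof (rule Least_equality)
      show "f (enat (m + 1)) \<noteq> g (enat (m + 1))" by (rule diff[OF fg])
      fix i assume "f i \<noteq> g i"
      show "enat (m + 1) \<le> i"
      proof (rule ccontr)
        assume "\<not> enat (m + 1) \<le> i"
        with fg have "f i = g i" by (simp add: A_def B_def x'_def)
        with \<open>f i \<noteq> g i\<close> show False ..
      qed
    qed
  qed
  have "y \<in> A"
  proof -
    have "x i = y i" if "i \<le> enat (m + 1)" for i
    proof -
      have "i < enat (m + 2)" using that by (rule order.strict_trans1) simp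
      then have "i < Delta x y" using xy(2) by (rule order.strict_trans2)
      then show ?thesis unfolding Delta_def using not_less_Least by blast
    qed
    then show ?thesis by (simp add: A_def)
  qed
  moreover have "x \<in> A" by (simp add: A_def)
  moreover have "infinite A" "infinite B"
    unfolding A_def B_def by (rule infinite_cone)+
  moreover have "A \<inter> B = {}" using diff by blast
  ultimately have "\<exists>u. monochromatic_cycle c UNIV (enat m) k u" if "k \<ge> 3" for k
    using monochromatic_cycle_bipartite_plus_edge[of A B c "enat m" x y k] bip xy that by blast
  then show ?thesis
    by (intro exI[of _ "enat m"]) simp
qed

end
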